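(* Assume that $\Omega$ is a nonempty, compact and totally disconnected metric space, with a nested sequence $\mathbf E=\{\mathcal E_n,\ n=0,1,2,\dots\}$ of finite partitions by clopen sets, where $\mathcal E_0=\{\Omega\}$. Suppose $\lim_{n\to\infty}m_n=0$, where $m_n$ is the mesh of $\mathcal E_n$. Then the function $\rho:B\to\mathbb R$ (defined in the context) extends to a Radon measure $\rho$ on $\Omega$, with $\rho(I)>0$ for every nonempty clopen set $I\subset\Omega$. The vector space $\mathbb V_{\mathbf E}$ is dense in $L^2(\rho)$.
   Context: Clopen means both open and closed. A sequence of partitions $\mathbf E=\{\mathcal E_n\}$ is nested if each $\mathcal E_{n+1}$ is a refinement of $\mathcal E_n$, i.e. each set in $\mathcal E_{n+1}$ is a subset of a set in $\mathcal E_n$; partitions consist of nonempty sets. The mesh $m_n$ of $\mathcal E_n$ is the maximum of the diameters of the sets in $\mathcal E_n$. For a partition $\mathcal E$ of $\Omega$ by clopen sets, $\mathbb V_{\mathcal E}$ is the real vector space spanned by the characteristic functions of the sets in $\mathcal E$, and $\mathbb V_{\mathbf E}=\bigcup_{n=0}^\infty\mathbb V_{\mathcal E_n}$. $B$ denotes the collection of all finite unions of sets taken from any of the partitions $\mathcal E_n$ (it is an algebra of sets). The function $\rho:B\to\mathbb R$ is defined as follows. Set $\rho(\emptyset)=0$ and $\rho(\Omega)=1$. Inductively, if $E\in\mathcal E_n$ and $\{E(m),\ m=1,\dots,M\}$ is the partition of $E$ by sets $E(m)\in\mathcal E_{n+1}$, set $\rho(E(m))=\rho(E)/M$ for each $m$.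 Any $S\in B$ is a union of finitely many distinct sets $S_k$ from a single partition $\mathcal E_N$; set $\rho(S)=\sum_k\rho(S_k)$, which does not depend on the choice of $N$. *)

theory Defs
  imports "HOL-Analysis.Analysis"
begin

definition totally_disconnected :: "'a::topological_space set \<Rightarrow> bool" where
  "totally_disconnected \<Omega> \<longleftrightarrow> (\<forall>C\<subseteq>\<Omega>. connected C \<longrightarrow> (\<exists>a. C \<subseteq> {a}))"

definition clopenin :: "'a topology \<Rightarrow> 'a set \<Rightarrow> bool" where
  "clopenin X S \<longleftrightarrow> openin X S \<and> closedin X S"

definition mesh :: "'a::metric_space set set \<Rightarrow> real" where
  "mesh P = Max (diameter ` P)"

(* The span of the characteristic functions of the cells of a finite partition P.
   A function on \<Omega> = \<Union>P is represented by its extension by 0 to the whole type. *)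
definition step_functions :: "'a set set \<Rightarrow> ('a \<Rightarrow> real) set" where
  "step_functions P = {f. \<exists>c. f = (\<lambda>x. \<Sum>A\<in>P. c A * indicator A x)}"

definition partition_algebra :: "(nat \<Rightarrow> 'a set set) \<Rightarrow> 'a set set" where
  "partition_algebra E = {\<Union>F |F. finite F \<and> F \<subseteq> (\<Union>n. E n)}"

(* The weight of A as a member of E n. In the recursion step the THE-term is the unique
   cell of E n that contains A, and the denominator is the number of pieces into which
   E (Suc n) splits that cell. *)
primrec cell_weight :: "(nat \<Rightarrow> 'a set set) \<Rightarrow> nat \<Rightarrow> 'a set \<Rightarrow> real" where
  "cell_weight E 0 A = 1"
| "cell_weight E (Suc n) A =
     (let P = (THE P. P \<in> E n \<and> A \<subseteq> P)
      in cell_weight E n P / real (card {C \<in> E (Suc n). C \<subseteq> P}))"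

(* The value is computed at the first level N for which S is a union of cells of E N;
   rho_Union below shows that any other such level gives the same value. *)
definition rho :: "(nat \<Rightarrow> 'a set set) \<Rightarrow> 'a set \<Rightarrow> real" where
  "rho E S = (let N = (LEAST N. \<exists>F\<subseteq>E N. S = \<Union>F)
              in \<Sum>A\<in>{A \<in> E N. A \<subseteq> S}. cell_weight E N A)"

lemma partition_cells_below_Union:
  assumes "partition_on \<Omega> P" "F \<subseteq> P"
  shows "{A \<in> P. A \<subseteq> \<Union>F} = F"
proof
  show "{A \<in> P. A \<subseteq> \<Union>F} \<subseteq> F"
  proof clarify
    fix A assume A: "A \<in> P" "A \<subseteq> \<Union>F"
    from A(1) assms(1) obtain x where x: "x \<in> A"
      unfolding partition_on_def by fastforce
    with A obtain B where "B \<in> F" "x \<in> B" by blast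
    with x A assms have "A = B"
      unfolding partition_on_def disjoint_def by blast
    with \<open>B \<in> F\<close> show "A \<in> F" by simp
  qed
qed (use assms in blast)

lemma refines_parent:
  assumes "refines \<Omega> Q P" "p \<in> P" "A \<in> Q" "A \<subseteq> p"
  shows "(THE p. p \<in> P \<and> A \<subseteq> p) = p"
proof (rule the_equality)
  fix q assume q: "q \<in> P \<and> A \<subseteq> q"
  have "{} \<notin> Q" and dis: "disjoint P"
    using assms(1) by (auto simp: refines_def partition_on_def)
  with assms(3) obtain x where x: "x \<in> A" by fastforce
  show "q = p"
  proof (rule ccontr)
    assume "q \<noteq> p"
    with dis q assms(2) have "q \<inter> p = {}" by (meson disjointD)
    with x q assms(4) show False by blast
  qed
qed (use assms in blast)

lemma refines_Union_children:
  assumes "refines \<Omega> Q P" "F \<subseteq> P"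
  shows "\<Union>{A \<in> Q. A \<subseteq> \<Union>F} = \<Union>F"
proof
  show "\<Union>F \<subseteq> \<Union>{A \<in> Q. A \<subseteq> \<Union>F}"
  proof clarify
    fix x p assume x: "p \<in> F" "x \<in> p"
    with assms obtain A where A: "A \<in> Q" "x \<in> A"
      unfolding refines_def partition_on_def by blast
    with assms obtain q where q: "q \<in> P" "A \<subseteq> q"
      unfolding refines_def by blast
    have dis: "disjoint P" using assms(1) by (simp add: refines_def partition_on_def)
    have "q = p"
    proof (rule ccontr)
      assume "q \<noteq> p"
      with dis q(1) x(1) assms(2) have "q \<inter> p = {}" by (meson disjointD subsetD)
      with q(2) A(2) x(2) show False by blast
    qed
    with q A x show "x \<in> \<Union>{A \<in> Q. A \<subseteq> \<Union>F}" by blast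
  qed
qed blast

lemma sum_cell_weight_children:
  assumes "refines \<Omega> (E (Suc n)) (E n)" "finite (E (Suc n))" "finite (E n)" "F \<subseteq> E n"
  shows "(\<Sum>A\<in>{A \<in> E (Suc n). A \<subseteq> \<Union>F}. cell_weight E (Suc n) A)
         = (\<Sum>P\<in>F. cell_weight E n P)"
proof -
  let ?ch = "\<lambda>P. {A \<in> E (Suc n). A \<subseteq> P}"
  have ne: "{} \<notin> E (Suc n)" and dis: "disjoint (E n)"
    using assms(1) by (auto simp: refines_def partition_on_def)
  have eq: "{A \<in> E (Suc n). A \<subseteq> \<Union>F} = (\<Union>P\<in>F. ?ch P)"
  proof
    show "{A \<in> E (Suc n). A \<subseteq> \<Union>F} \<subseteq> (\<Union>P\<in>F. ?ch P)"
    proof clarify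
      fix A assume A: "A \<in> E (Suc n)" "A \<subseteq> \<Union>F"
      then obtain x where x: "x \<in> A" using ne by fastforce
      from A assms(1) obtain q where q: "q \<in> E n" "A \<subseteq> q"
        unfolding refines_def by blast
      from x A obtain p where p: "p \<in> F" "x \<in> p" by blast
      have "q = p" using q p x dis assms(4) unfolding disjoint_def by blast
      with p q A show "A \<in> (\<Union>P\<in>F. ?ch P)" by blast
    qed
  qed blast
  have disj: "\<forall>P\<in>F. \<forall>Q\<in>F. P \<noteq> Q \<longrightarrow> ?ch P \<inter> ?ch Q = {}"
  proof clarify
    fix P Q assume "P \<in> F" "Q \<in> F" "P \<noteq> Q"
    then have "P \<inter> Q = {}" using dis assms(4) unfolding disjoint_def by blast
    have False if "A \<in> E (Suc n)" "A \<subseteq> P" "A \<subseteq> Q" for A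
    proof -
      have "A = {}" using that(2,3) \<open>P \<inter> Q = {}\<close> by blast
      with that(1) ne show False by simp
    qed
    then show "?ch P \<inter> ?ch Q = {}" by blast
  qed
  have piece: "(\<Sum>A\<in>?ch P. cell_weight E (Suc n) A) = cell_weight E n P" if P: "P \<in> F" for P
  proof -
    have PE: "P \<in> E n" using P assms(4) by blast
    have "P \<noteq> {}" using PE assms(1) unfolding refines_def partition_on_def by blast
    moreover have "\<Union>(?ch P) = P"
      using refines_Union_children[OF assms(1), of "{P}"] PE by simp
    ultimately have "?ch P \<noteq> {}" by (metis Union_empty)
    then have "card (?ch P) \<noteq> 0" using assms(2) by simp
    moreover have "(\<Sum>A\<in>?ch P. cell_weight E (Suc n) A)
                   = (\<Sum>A\<in>?ch P. cell_weight E n P / real (card (?ch P)))"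
      by (rule sum.cong) (auto simp: refines_parent[OF assms(1) PE])
    ultimately show ?thesis by simp
  qed
  have "finite F" using assms(3,4) by (rule rev_finite_subset)
  then show ?thesis
    unfolding eq using assms(2) disj piece by (subst sum.UNION_disjoint) auto
qed

lemma rho_Union:
  assumes "\<And>n. finite (E n)" "\<And>n. refines \<Omega> (E (Suc n)) (E n)" "F \<subseteq> E N"
  shows "rho E (\<Union>F) = (\<Sum>A\<in>F. cell_weight E N A)"
proof -
  define S where "S = \<Union>F"
  let ?Q = "\<lambda>N. \<exists>F\<subseteq>E N. S = \<Union>F"
  let ?s = "\<lambda>k. \<Sum>A\<in>{A \<in> E k. A \<subseteq> S}. cell_weight E k A"
  define L where "L = (LEAST N. ?Q N)"
  have part: "partition_on \<Omega> (E n)" for n using assms(2) by (simp add: refines_def)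
  have QN: "?Q N" using assms(3) S_def by blast
  have "?Q L" unfolding L_def using QN by (rule LeastI)
  have up: "?Q k \<and> ?s k = ?s L" if "L \<le> k" for k
    using that
  proof (induction k rule: dec_induct)
    case base
    show ?case using \<open>?Q L\<close> by simp
  next
    case (step k)
    then obtain G where G: "G \<subseteq> E k" "S = \<Union>G" by blast
    have "\<Union>{A \<in> E (Suc k). A \<subseteq> S} = S"
      using refines_Union_children[OF assms(2) G(1)] G(2) by simp
    then have "?Q (Suc k)" by (intro exI[of _ "{A \<in> E (Suc k). A \<subseteq> S}"]) auto
    moreover have "?s (Suc k) = ?s k"
      using sum_cell_weight_children[where E = E, OF assms(2) assms(1) assms(1) G(1)]
        partition_cells_below_Union[OF part G(1)] G(2) by simp
    ultimately show ?case using step by simp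
  qed
  have "L \<le> N" unfolding L_def using QN by (rule Least_le)
  from conjunct2[OF up[OF this]] have "?s L = ?s N" by (rule sym)
  moreover have "{A \<in> E N. A \<subseteq> S} = F"
    unfolding S_def by (rule partition_cells_below_Union[OF part assms(3)])
  moreover have "rho E S = ?s L" unfolding rho_def L_def Let_def ..
  ultimately show ?thesis unfolding S_def by (simp only:)
qed

(* Local finiteness is not listed separately: it follows from finiteness on compact sets
   and outer regularity, applied to singletons. *)
definition radon_measure_on :: "'a::t2_space set \<Rightarrow> 'a measure \<Rightarrow> bool" where
  "radon_measure_on \<Omega> M \<longleftrightarrow>
     sets M = sets (restrict_space borel \<Omega>) \<and>
     (\<forall>K\<subseteq>\<Omega>. compact K \<longrightarrow> emeasure M K < \<infinity>) \<and>
     (\<forall>A\<in>sets M. emeasure M A =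
        (INF U\<in>{U. openin (top_of_set \<Omega>) U \<and> A \<subseteq> U}. emeasure M U)) \<and>
     (\<forall>A\<in>sets M. emeasure M A = (SUP K\<in>{K. compact K \<and> K \<subseteq> A}. emeasure M K))"

(* Real L^2 as a space of functions with a seminorm. Functions that agree almost everywhere
   are not identified; this does not affect density, since the seminorm does not
   distinguish them. *)
definition L2_functions :: "'a measure \<Rightarrow> ('a \<Rightarrow> real) set" where
  "L2_functions M = {f \<in> borel_measurable M. integrable M (\<lambda>x. (f x)\<^sup>2)}"

definition L2_norm :: "'a measure \<Rightarrow> ('a \<Rightarrow> real) \<Rightarrow> real" where
  "L2_norm M f = sqrt (\<integral>x. (f x)\<^sup>2 \<partial>M)"

definition dense_in_L2 :: "'a measure \<Rightarrow> ('a \<Rightarrow> real) set \<Rightarrow> bool" where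
  "dense_in_L2 M V \<longleftrightarrow> V \<subseteq> L2_functions M \<and>
     (\<forall>f\<in>L2_functions M. \<forall>e>0. \<exists>g\<in>V. L2_norm M (\<lambda>x. f x - g x) < e)"

end

theory Submission
  imports Defs
begin

text \<open>The set function \<open>rho\<close> is finitely additive on the algebra of finite unions of cells. A decreasing
  sequence of clopen sets with empty intersection is eventually empty by compactness, so \<open>rho\<close> is
  continuous at the empty set and Caratheodory's theorem extends it to the generated sigma-algebra.
  As the mesh tends to 0, every relatively open set is the union of the countably many cells inside
  it, so this sigma-algebra is the Borel one, and nonempty open sets contain a cell, which has
  positive weight. The sets that can be enclosed between a closed and an open set of nearly the
  same measure form a sigma-algebra containing the clopen generators, which gives regularity. A
  compact \<open>K\<close> inside an open \<open>U\<close> admits a finite union of cells in between, so indicators of Borel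
  sets, hence simple functions, are \<open>L\<^sup>2\<close>-limits of step functions.\<close>

section \<open>Approximation by step functions\<close>

lemma L2_functions_cmult: "f \<in> L2_functions M \<Longrightarrow> (\<lambda>x. c * f x) \<in> L2_functions M"
  by (auto simp: L2_functions_def power_mult_distrib)

text \<open>A crude substitute for the triangle inequality. It keeps all estimates at the level of
  squared integrals, so neither square roots nor Minkowski's inequality are required.\<close>

lemma power2_add_le: "(a + b)\<^sup>2 \<le> 2 * a\<^sup>2 + 2 * b\<^sup>2" for a b :: real
  using sum_squares_bound[of a b] by (simp add: power2_sum)

lemma L2_functions_add:
  assumes "f \<in> L2_functions M" "g \<in> L2_functions M"
  shows "(\<lambda>x. f x + g x) \<in> L2_functions M"
proof -
  have [measurable]: "f \<in> borel_measurable M" "g \<in> borel_measurable M"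
    using assms by (auto simp: L2_functions_def)
  have "integrable M (\<lambda>x. 2 * (f x)\<^sup>2 + 2 * (g x)\<^sup>2)"
    using assms by (auto simp: L2_functions_def)
  then have "integrable M (\<lambda>x. (f x + g x)\<^sup>2)"
    by (rule Bochner_Integration.integrable_bound) (auto simp: power2_add_le)
  then show ?thesis by (simp add: L2_functions_def)
qed

lemma L2_functions_diff:
  assumes "f \<in> L2_functions M" "g \<in> L2_functions M"
  shows "(\<lambda>x. f x - g x) \<in> L2_functions M"
  using L2_functions_add[OF assms(1) L2_functions_cmult[OF assms(2), of "-1"]] by simp

lemma L2_functions_sum:
  assumes "\<And>i. i \<in> I \<Longrightarrow> f i \<in> L2_functions M"
  shows "(\<lambda>x. \<Sum>i\<in>I. f i x) \<in> L2_functions M"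
  using assms
  by (induction I rule: infinite_finite_induct)
     (auto simp: L2_functions_add, auto simp: L2_functions_def)

lemma (in finite_measure) indicator_in_L2_functions:
  assumes "A \<in> sets M"
  shows "indicator A \<in> L2_functions M"
proof -
  have "integrable M (\<lambda>x. (indicator A x :: real)\<^sup>2)"
    using assms by (intro integrable_const_bound[of _ 1]) (auto simp: indicator_def)
  then show ?thesis
    using assms by (simp add: L2_functions_def)
qed

text \<open>Integrating \<open>power2_add_le\<close> gives a triangle inequality for the squared
  norm up to a factor 2, which is where the quarters in the density argument come from.\<close>

lemma integral_sq_add_le:
  assumes "f \<in> L2_functions M" "g \<in> L2_functions M"
  shows "(\<integral>x. (f x + g x)\<^sup>2 \<partial>M) \<le> 2 * (\<integral>x. (f x)\<^sup>2 \<partial>M) + 2 * (\<integral>x. (g x)\<^sup>2 \<partial>M)"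
proof -
  have i: "integrable M (\<lambda>x. (f x)\<^sup>2)" "integrable M (\<lambda>x. (g x)\<^sup>2)"
      "integrable M (\<lambda>x. (f x + g x)\<^sup>2)"
    using assms L2_functions_add[OF assms] by (auto simp: L2_functions_def)
  have "(\<integral>x. (f x + g x)\<^sup>2 \<partial>M) \<le> (\<integral>x. 2 * (f x)\<^sup>2 + 2 * (g x)\<^sup>2 \<partial>M)"
    using i by (intro integral_mono) (auto simp: power2_add_le)
  then show ?thesis using i by simp
qed

text \<open>The functions approximable from the vector space \<open>V\<close> are closed under
  linear combinations. Once they contain indicators of measurable sets they contain simple
  functions, and these approximate every square-integrable function by dominated
  convergence.\<close>

lemma (in finite_measure) dense_in_L2I:
  assumes sub: "V \<subseteq> L2_functions M"
    and zero: "(\<lambda>x. 0) \<in> V"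
    and add: "\<And>f g. f \<in> V \<Longrightarrow> g \<in> V \<Longrightarrow> (\<lambda>x. f x + g x) \<in> V"
    and scale: "\<And>c f. f \<in> V \<Longrightarrow> (\<lambda>x. c * f x) \<in> V"
    and ind: "\<And>A e. A \<in> sets M \<Longrightarrow> 0 < e \<Longrightarrow> \<exists>g\<in>V. (\<integral>x. (indicator A x - g x)\<^sup>2 \<partial>M) < e"
  shows "dense_in_L2 M V"
proof -
  \<comment> \<open>Membership in L2 is part of the predicate because the Bochner integral of a
    non-integrable function is 0, so a small integral alone would say nothing.\<close>
  define ok where
    "ok f \<longleftrightarrow> f \<in> L2_functions M \<and> (\<forall>e>0. \<exists>g\<in>V. (\<integral>x. (f x - g x)\<^sup>2 \<partial>M) < e)" for f
  have ok_add: "ok (\<lambda>x. f x + f' x)" if f: "ok f" and f': "ok f'" for f f'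
    unfolding ok_def
  proof (intro conjI allI impI)
    show "(\<lambda>x. f x + f' x) \<in> L2_functions M"
      using f f' by (auto simp: ok_def intro: L2_functions_add)
    fix e :: real assume "0 < e"
    \<comment> \<open>Two errors below \<open>e / 4\<close>, each doubled by
      \<open>integral_sq_add_le\<close>, add up to less than \<open>e\<close>.\<close>
    then have e4: "0 < e / 4" by simp
    obtain g where g: "g \<in> V" "(\<integral>x. (f x - g x)\<^sup>2 \<partial>M) < e / 4"
      using f e4 unfolding ok_def by blast
    obtain g' where g': "g' \<in> V" "(\<integral>x. (f' x - g' x)\<^sup>2 \<partial>M) < e / 4"
      using f' e4 unfolding ok_def by blast
    have "(\<lambda>x. f x - g x) \<in> L2_functions M" "(\<lambda>x. f' x - g' x) \<in> L2_functions M"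
      using f f' g g' sub by (auto simp: ok_def intro!: L2_functions_diff)
    from integral_sq_add_le[OF this] g g'
    have "(\<integral>x. (f x + f' x - (g x + g' x))\<^sup>2 \<partial>M) < e"
      by (simp add: algebra_simps)
    with add[OF g(1) g'(1)] show "\<exists>g\<in>V. (\<integral>x. (f x + f' x - g x)\<^sup>2 \<partial>M) < e"
      by (intro bexI[of _ "\<lambda>x. g x + g' x"])
  qed
  have ok_scale: "ok (\<lambda>x. c * f x)" if f: "ok f" for f c
    unfolding ok_def
  proof (intro conjI allI impI)
    show "(\<lambda>x. c * f x) \<in> L2_functions M"
      using f by (auto simp: ok_def intro: L2_functions_cmult)
    fix e :: real assume "0 < e"
    \<comment> \<open>Dividing by 1 + c^2 instead of c^2 also covers c = 0.\<close>
    have "0 < 1 + c\<^sup>2" by (simp add: add_pos_nonneg)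
    then have "0 < e / (1 + c\<^sup>2)" using \<open>0 < e\<close> by simp
    then obtain g where g: "g \<in> V" "(\<integral>x. (f x - g x)\<^sup>2 \<partial>M) < e / (1 + c\<^sup>2)"
      using f unfolding ok_def by blast
    have "(\<integral>x. (c * f x - c * g x)\<^sup>2 \<partial>M) = c\<^sup>2 * (\<integral>x. (f x - g x)\<^sup>2 \<partial>M)"
      by (simp flip: right_diff_distrib add: power_mult_distrib)
    also have "\<dots> \<le> (1 + c\<^sup>2) * (\<integral>x. (f x - g x)\<^sup>2 \<partial>M)"
      by (simp add: distrib_right)
    also have "\<dots> < e"
      using g(2) \<open>0 < 1 + c\<^sup>2\<close> by (simp add: field_simps)
    finally show "\<exists>g\<in>V. (\<integral>x. (c * f x - g x)\<^sup>2 \<partial>M) < e"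
      using scale[OF g(1)] by (intro bexI[of _ "\<lambda>x. c * g x"])
  qed
  have ok_zero: "ok (\<lambda>x. 0)"
    unfolding ok_def using zero sub by (auto intro!: bexI[of _ "\<lambda>x. 0"])
  have ok_ind: "ok (indicator A)" if "A \<in> sets M" for A
    using that ind indicator_in_L2_functions by (auto simp: ok_def)
  \<comment> \<open>The set of values \<open>Y\<close> is kept separate from the range of
    \<open>s\<close>, so that the induction can remove values while \<open>s\<close> stays
    fixed.\<close>
  have ok_simple: "ok (\<lambda>x. \<Sum>y\<in>Y. y * indicator (s -` {y} \<inter> space M) x)"
    if s: "simple_function M s" and "finite Y" for s :: "'a \<Rightarrow> real" and Y
    using that(2)
  proof induction
    case (insert y Y)
    have "s -` {y} \<inter> space M \<in> sets M"
      using borel_measurable_simple_function[OF s] by measurable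
    then show ?case
      unfolding sum.insert[OF insert.hyps] by (intro ok_add ok_scale ok_ind insert.IH)
  qed (simp add: ok_zero)
  have "\<exists>g\<in>V. L2_norm M (\<lambda>x. f x - g x) < e" if f: "f \<in> L2_functions M" and "0 < e" for f e
  proof -
    have fm [measurable]: "f \<in> borel_measurable M" and fi: "integrable M (\<lambda>x. (f x)\<^sup>2)"
      using f by (auto simp: L2_functions_def)
    obtain s where s: "\<And>i. simple_function M (s i)"
      and lim: "\<And>x. x \<in> space M \<Longrightarrow> (\<lambda>i. s i x) \<longlonglongrightarrow> f x"
      and bound: "\<And>i x. x \<in> space M \<Longrightarrow> \<bar>s i x\<bar> \<le> 2 * \<bar>f x\<bar>"
      using borel_measurable_implies_sequence_metric[OF fm, of 0] by simp metis
    have sm [measurable]: "s i \<in> borel_measurable M" for i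
      using s by (rule borel_measurable_simple_function)
    have "(\<lambda>i. \<integral>x. (f x - s i x)\<^sup>2 \<partial>M) \<longlonglongrightarrow> (\<integral>x. 0 \<partial>M)"
    \<comment> \<open>From |s| \<le> 2 |f| follows |f - s| \<le> 3 |f|, whose square is the
      dominating function.\<close>
    proof (rule integral_dominated_convergence[where w = "\<lambda>x. 9 * (f x)\<^sup>2"])
      show "AE x in M. (\<lambda>i. (f x - s i x)\<^sup>2) \<longlonglongrightarrow> 0"
        using lim by (intro AE_I2) (auto intro!: tendsto_eq_intros)
      show "AE x in M. norm ((f x - s i x)\<^sup>2) \<le> 9 * (f x)\<^sup>2" for i
      proof (intro AE_I2)
        fix x assume "x \<in> space M"
        then have "\<bar>f x - s i x\<bar> \<le> \<bar>3 * f x\<bar>" using bound[of x i] by linarith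
        then have "(f x - s i x)\<^sup>2 \<le> (3 * f x)\<^sup>2" by (simp only: abs_le_square_iff)
        then show "norm ((f x - s i x)\<^sup>2) \<le> 9 * (f x)\<^sup>2" by (simp add: power_mult_distrib)
      qed
    qed (use fi in auto)
    \<comment> \<open>The target is e^2, the square of the required \<open>L2_norm\<close> bound. It
      is split as twice e^2 / 4 for f against s plus twice e^2 / 4 for s against the step
      function.\<close>
    then have "\<forall>\<^sub>F i in sequentially. (\<integral>x. (f x - s i x)\<^sup>2 \<partial>M) < e\<^sup>2 / 4"
      using \<open>0 < e\<close> by (intro order_tendstoD) auto
    then obtain i where i: "(\<integral>x. (f x - s i x)\<^sup>2 \<partial>M) < e\<^sup>2 / 4"
      by (auto simp: eventually_sequentially)
    \<comment> \<open>The canonical form of \<open>s i\<close>, to which \<open>ok_simple\<close>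
      applies literally. It vanishes outside \<open>space M\<close>, so the two functions need agree
      only on \<open>space M\<close>, which is enough for the integrals.\<close>
    define t where "t x = (\<Sum>y\<in>s i ` space M. y * indicator (s i -` {y} \<inter> space M) x)" for x
    have ts: "t x = s i x" if "x \<in> space M" for x
    proof -
      have "t x = (\<Sum>y\<in>s i ` space M. if y = s i x then y else 0)"
        unfolding t_def using that by (intro sum.cong) (auto split: split_indicator)
      then show ?thesis
        using that s[of i] by (simp add: simple_function_def)
    qed
    have "ok t"
      unfolding t_def using s[of i] by (intro ok_simple) (auto simp: simple_function_def)
    moreover have "0 < e\<^sup>2 / 4" using \<open>0 < e\<close> by simp
    ultimately obtain g
      where t: "t \<in> L2_functions M" and g: "g \<in> V" "(\<integral>x. (t x - g x)\<^sup>2 \<partial>M) < e\<^sup>2 / 4"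
      unfolding ok_def by blast
    have "(\<integral>x. (f x - t x)\<^sup>2 \<partial>M) = (\<integral>x. (f x - s i x)\<^sup>2 \<partial>M)"
      by (intro Bochner_Integration.integral_cong) (auto simp: ts)
    moreover have "(\<lambda>x. f x - t x) \<in> L2_functions M" "(\<lambda>x. t x - g x) \<in> L2_functions M"
      using f t g sub by (auto intro!: L2_functions_diff)
    from integral_sq_add_le[OF this]
    have "(\<integral>x. (f x - g x)\<^sup>2 \<partial>M) \<le> 2 * (\<integral>x. (f x - t x)\<^sup>2 \<partial>M) + 2 * (\<integral>x. (t x - g x)\<^sup>2 \<partial>M)"
      by simp
    ultimately have "(\<integral>x. (f x - g x)\<^sup>2 \<partial>M) < e\<^sup>2" using i g by linarith
    then have "L2_norm M (\<lambda>x. f x - g x) < e"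
      unfolding L2_norm_def using \<open>0 < e\<close> by (intro real_less_lsqrt) auto
    with g show ?thesis by blast
  qed
  with sub show ?thesis by (auto simp: dense_in_L2_def)
qed

section \<open>The vector space of step functions on one partition\<close>

lemma step_functions_zero: "(\<lambda>x. 0) \<in> step_functions P"
  unfolding step_functions_def by (auto intro!: exI[of _ "\<lambda>_. 0"])

lemma step_functions_add:
  assumes "f \<in> step_functions P" "g \<in> step_functions P"
  shows "(\<lambda>x. f x + g x) \<in> step_functions P"
proof -
  obtain c d where "f = (\<lambda>x. \<Sum>A\<in>P. c A * indicator A x)" "g = (\<lambda>x. \<Sum>A\<in>P. d A * indicator A x)"
    using assms by (auto simp: step_functions_def)
  then show ?thesis
    unfolding step_functions_def
    by (auto intro!: exI[of _ "\<lambda>A. c A + d A"] simp: distrib_right sum.distrib)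
qed

lemma step_functions_cmult:
  assumes "f \<in> step_functions P"
  shows "(\<lambda>x. a * f x) \<in> step_functions P"
proof -
  obtain c where "f = (\<lambda>x. \<Sum>A\<in>P. c A * indicator A x)"
    using assms by (auto simp: step_functions_def)
  then show ?thesis
    unfolding step_functions_def
    by (auto intro!: exI[of _ "\<lambda>A. a * c A"] simp: sum_distrib_left mult.assoc)
qed

lemma step_functions_sum:
  assumes "\<And>i. i \<in> I \<Longrightarrow> f i \<in> step_functions P"
  shows "(\<lambda>x. \<Sum>i\<in>I. f i x) \<in> step_functions P"
  using assms
  by (induction I rule: infinite_finite_induct)
     (auto simp: step_functions_zero step_functions_add)

section \<open>Regularity of measures generated by clopen sets\<close>

text \<open>Induction over the generation of the sigma-algebra. A clopen generator serves as its own
  \<open>K\<close> and \<open>U\<close>, complementation exchanges the two roles, and only countable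
  unions require an estimate.\<close>

lemma (in finite_measure) closed_open_approximation:
  assumes T: "topspace T = space M" "\<And>U. openin T U \<Longrightarrow> U \<in> sets M"
    and gen: "sets M = sigma_sets (space M) G"
    and clopen: "\<And>A. A \<in> G \<Longrightarrow> clopenin T A"
    and "A \<in> sets M" "0 < e"
  obtains K U where "closedin T K" "openin T U" "K \<subseteq> A" "A \<subseteq> U" "measure M (U - K) < e"
proof -
  have closed: "K \<in> sets M" if "closedin T K" for K
  proof -
    have "topspace T - K \<in> sets M" "K \<subseteq> space M"
      using that T by (auto simp: closedin_def)
    then have "space M - (space M - K) \<in> sets M" using T(1) by (metis sets.compl_sets)
    with \<open>K \<subseteq> space M\<close> show ?thesis by (simp add: double_diff)
  qed
  have "A \<in> sigma_sets (space M) G" using assms(5) gen by simp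
  then have "\<forall>e>0. \<exists>K U. closedin T K \<and> openin T U \<and> K \<subseteq> A \<and> A \<subseteq> U \<and> measure M (U - K) < e"
  proof (induction rule: sigma_sets.induct)
    case (Basic A)
    with clopen[of A] show ?case
      by (intro allI impI exI[of _ A]) (auto simp: clopenin_def)
  next
    case Empty
    show ?case by (intro allI impI exI[of _ "{}"]) auto
  next
    case (Compl A)
    show ?case
    proof (intro allI impI)
      fix e :: real assume "0 < e"
      then obtain K U
        where KU: "closedin T K" "openin T U" "K \<subseteq> A" "A \<subseteq> U" "measure M (U - K) < e"
        using Compl.IH by meson
      have "U \<subseteq> space M" using KU T openin_subset by blast
      \<comment> \<open>Passing to complements swaps the closed and the open set and leaves their
        difference unchanged.\<close>
      then have "(space M - K) - (space M - U) = U - K" by blast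
      moreover have "closedin T (space M - U)" "openin T (space M - K)"
        using KU unfolding T(1)[symmetric] by (auto intro: closedin_diff openin_diff)
      ultimately show "\<exists>K U. closedin T K \<and> openin T U \<and> K \<subseteq> space M - A \<and> space M - A \<subseteq> U
          \<and> measure M (U - K) < e"
        using KU(3-5) by (intro exI[of _ "space M - U"] exI[of _ "space M - K"]) (simp add: Diff_mono)
    qed
  next
    case (Union a)
    show ?case
    proof (intro allI impI)
      fix e :: real assume e: "0 < e"
      \<comment> \<open>The errors sum to \<open>e / 2\<close>, not \<open>e\<close>. The series
        bound is only non-strict, and a strict bound by \<open>e\<close> is needed for the passage
        to a finite stage below.\<close>
      define d where "d i = e / 2 * (1/2) ^ Suc i" for i :: nat
      have "0 < d i" for i using e by (simp add: d_def)
      then have "\<forall>i. \<exists>K U. closedin T K \<and> openin T U \<and> K \<subseteq> a i \<and> a i \<subseteq> U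
          \<and> measure M (U - K) < d i"
        using Union.IH by blast
      then obtain K U where KU: "\<And>i. closedin T (K i)" "\<And>i. openin T (U i)" "\<And>i. K i \<subseteq> a i"
          "\<And>i. a i \<subseteq> U i" "\<And>i. measure M (U i - K i) < d i"
        by metis
      have [measurable]: "K i \<in> sets M" "U i \<in> sets M" for i using KU closed T by auto
      define V where "V = (\<Union>i. U i)"
      have dsum: "d sums (e / 2)"
        unfolding d_def using sums_mult[OF power_half_series, of "e/2"] by simp
      have sm: "summable (\<lambda>i. measure M (U i - K i))"
        using sums_summable[OF dsum] by (rule summable_comparison_test') (simp add: KU less_imp_le)
      have "measure M (V - (\<Union>i. K i)) \<le> measure M (\<Union>i. U i - K i)"
        unfolding V_def by (intro finite_measure_mono) auto
      also have "\<dots> \<le> (\<Sum>i. measure M (U i - K i))"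
        using sm by (intro finite_measure_subadditive_countably) auto
      also have "\<dots> \<le> suminf d"
        using sm sums_summable[OF dsum] KU by (intro suminf_le) (auto intro: less_imp_le)
      also have "\<dots> < e" using sums_unique[OF dsum] e by simp
      finally have lt: "measure M (V - (\<Union>i. K i)) < e" .
      \<comment> \<open>An infinite union of closed sets need not be closed. Continuity from above,
        valid in a finite measure, shows that a finite partial union already leaves an error below
        \<open>e\<close>.\<close>
      have "(\<lambda>n. measure M (V - (\<Union>i\<le>n. K i))) \<longlonglongrightarrow> measure M (\<Inter>n. V - (\<Union>i\<le>n. K i))"
      proof (rule finite_Lim_measure_decseq)
        show "decseq (\<lambda>n. V - (\<Union>i\<le>n. K i))"
          unfolding decseq_def by (intro allI impI Diff_mono UN_mono) auto
        show "range (\<lambda>n. V - (\<Union>i\<le>n. K i)) \<subseteq> sets M"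
          unfolding V_def by auto
      qed
      also have "(\<Inter>n. V - (\<Union>i\<le>n. K i)) = V - (\<Union>i. K i)" by auto
      finally have "\<forall>\<^sub>F n in sequentially. measure M (V - (\<Union>i\<le>n. K i)) < e"
        using lt by (rule order_tendstoD)
      then obtain n where "measure M (V - (\<Union>i\<le>n. K i)) < e"
        by (auto simp: eventually_sequentially)
      moreover have "openin T V" unfolding V_def using KU by auto
      moreover have "closedin T (\<Union>i\<le>n. K i)" using KU by (intro closedin_Union) auto
      ultimately show "\<exists>K U. closedin T K \<and> openin T U \<and> K \<subseteq> (\<Union>i. a i) \<and> (\<Union>i. a i) \<subseteq> U
          \<and> measure M (U - K) < e"
        using KU(3,4) unfolding V_def
        by (intro exI[of _ "\<Union>i\<le>n. K i"] exI[of _ "\<Union>i. U i"] conjI UN_mono) auto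
    qed
  qed
  then show thesis using \<open>0 < e\<close> that by meson
qed

text \<open>Relatively closed subsets of a compact set are compact, so one closed-open sandwich
  yields both regularity properties: U - A and A - K lie inside U - K.\<close>

lemma radon_measure_onI:
  fixes \<Omega> :: "'a::t2_space set"
  assumes "finite_measure M"
    and sets: "sets M = sets (restrict_space borel \<Omega>)"
    and "compact \<Omega>"
    and approx: "\<And>A e. A \<in> sets M \<Longrightarrow> 0 < e \<Longrightarrow>
      \<exists>K U. closedin (top_of_set \<Omega>) K \<and> openin (top_of_set \<Omega>) U \<and> K \<subseteq> A \<and> A \<subseteq> U
        \<and> measure M (U - K) < e"
  shows "radon_measure_on \<Omega> M"
proof -
  interpret finite_measure M by fact
  have op: "U \<in> sets M" if "openin (top_of_set \<Omega>) U" for U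
    using that unfolding sets sets_restrict_space openin_open by auto
  have cl: "K \<in> sets M" if "closedin (top_of_set \<Omega>) K" for K
  proof -
    obtain C where "closed C" "K = \<Omega> \<inter> C"
      using \<open>closedin (top_of_set \<Omega>) K\<close> unfolding closedin_closed by blast
    then show ?thesis
      unfolding sets sets_restrict_space by (simp add: borel_closed)
  qed
  have le: "emeasure M U \<le> emeasure M K + ennreal e"
    if "K \<in> sets M" "U \<in> sets M" "K \<subseteq> U" "measure M (U - K) < e" for K U e
  proof -
    have "measure M U = measure M K + measure M (U - K)"
      using that by (simp add: finite_measure_Diff)
    \<comment> \<open>\<open>ennreal\<close> truncates negative reals to 0, so splitting it over a
      sum needs the sign of \<open>e\<close>.\<close>
    moreover have "0 < e" using that(4) measure_nonneg[of M "U - K"] by linarith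
    ultimately show ?thesis
      using that by (simp add: emeasure_eq_measure flip: ennreal_plus)
  qed
  have outer: "emeasure M A = (INF U\<in>{U. openin (top_of_set \<Omega>) U \<and> A \<subseteq> U}. emeasure M U)"
    if A: "A \<in> sets M" for A
  proof (rule antisym)
    show "emeasure M A \<le> (INF U\<in>{U. openin (top_of_set \<Omega>) U \<and> A \<subseteq> U}. emeasure M U)"
      by (auto intro!: INF_greatest emeasure_mono op)
    show "(INF U\<in>{U. openin (top_of_set \<Omega>) U \<and> A \<subseteq> U}. emeasure M U) \<le> emeasure M A"
    proof (rule ennreal_le_epsilon)
      fix e :: real assume "0 < e"
      from approx[OF A this] obtain K U where KU: "closedin (top_of_set \<Omega>) K" "openin (top_of_set \<Omega>) U"
        "K \<subseteq> A" "A \<subseteq> U" "measure M (U - K) < e" by blast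
      have "measure M (U - A) \<le> measure M (U - K)"
        using KU op cl by (intro finite_measure_mono) auto
      with KU(5) have "emeasure M U \<le> emeasure M A + ennreal e"
        by (intro le[OF A op[OF KU(2)] KU(4)]) simp
      moreover have "(INF U\<in>{U. openin (top_of_set \<Omega>) U \<and> A \<subseteq> U}. emeasure M U) \<le> emeasure M U"
        using KU by (intro INF_lower) simp
      ultimately show "(INF U\<in>{U. openin (top_of_set \<Omega>) U \<and> A \<subseteq> U}. emeasure M U)
          \<le> emeasure M A + ennreal e"
        by (rule order_trans[rotated])
    qed
  qed
  have inner: "emeasure M A = (SUP K\<in>{K. compact K \<and> K \<subseteq> A}. emeasure M K)"
    if A: "A \<in> sets M" for A
  proof (rule antisym)
    show "(SUP K\<in>{K. compact K \<and> K \<subseteq> A}. emeasure M K) \<le> emeasure M A"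
      using A by (auto intro!: SUP_least emeasure_mono)
    show "emeasure M A \<le> (SUP K\<in>{K. compact K \<and> K \<subseteq> A}. emeasure M K)"
    proof (rule ennreal_le_epsilon)
      fix e :: real assume "0 < e"
      from approx[OF A this] obtain K U where KU: "closedin (top_of_set \<Omega>) K" "openin (top_of_set \<Omega>) U"
        "K \<subseteq> A" "A \<subseteq> U" "measure M (U - K) < e" by blast
      have "measure M (A - K) \<le> measure M (U - K)"
        using KU op cl A by (intro finite_measure_mono) auto
      with KU(5) have "emeasure M A \<le> emeasure M K + ennreal e"
        by (intro le[OF cl[OF KU(1)] A KU(3)]) simp
      also have "compact K" using KU(1) \<open>compact \<Omega>\<close> closedin_compact by blast
      then have "emeasure M K + ennreal e
          \<le> (SUP K\<in>{K. compact K \<and> K \<subseteq> A}. emeasure M K) + ennreal e"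
        using KU by (intro add_right_mono SUP_upper) auto
      finally show "emeasure M A \<le> (SUP K\<in>{K. compact K \<and> K \<subseteq> A}. emeasure M K) + ennreal e" .
    qed
  qed
  show ?thesis
    unfolding radon_measure_on_def using sets outer inner
    by (auto simp: top.not_eq_extremum[symmetric])
qed

section \<open>The algebra of a refining sequence of clopen partitions\<close>

locale clopen_partitions =
  fixes \<Omega> :: "'a::metric_space set" and E :: "nat \<Rightarrow> 'a set set"
  assumes compact: "compact \<Omega>"
    and finite_cells: "\<And>n. finite (E n)"
    and clopen_cells: "\<And>n A. A \<in> E n \<Longrightarrow> clopenin (top_of_set \<Omega>) A"
    and refines: "\<And>n. refines \<Omega> (E (Suc n)) (E n)"
    and mesh_tendsto_0: "(\<lambda>n. mesh (E n)) \<longlonglongrightarrow> 0"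
begin

abbreviation B :: "'a set set" where "B \<equiv> partition_algebra E"

lemma partition: "partition_on \<Omega> (E n)"
  using refines by (simp add: refines_def)

lemma Union_cells: "\<Union>(E n) = \<Omega>"
  using partition by (simp add: partition_on_def)

lemma disjoint_cells: "P \<in> E n \<Longrightarrow> Q \<in> E n \<Longrightarrow> P \<noteq> Q \<Longrightarrow> P \<inter> Q = {}"
  using partition[of n] by (auto simp: partition_on_def disjoint_def)

lemma cell_nonempty: "A \<in> E n \<Longrightarrow> A \<noteq> {}"
  using partition[of n] by (auto simp: partition_on_def)

text \<open>Every cell is the union of its children, so a union of cells can be rewritten one level
  further down repeatedly. This moves sets from different levels onto a common one.\<close>

lemma Union_cells_at_later_level:
  assumes "F \<subseteq> E n" "n \<le> m"
  obtains G where "G \<subseteq> E m" "\<Union>G = \<Union>F"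
proof -
  have "\<exists>G\<subseteq>E m. \<Union>G = \<Union>F"
    using assms(2)
  proof (induction m rule: dec_induct)
    case base
    show ?case using assms(1) by blast
  next
    case (step m)
    from step.IH obtain G where G: "G \<subseteq> E m" "\<Union>G = \<Union>F" by meson
    have "\<Union>{A \<in> E (Suc m). A \<subseteq> \<Union>G} = \<Union>F"
      unfolding refines_Union_children[OF refines G(1)] by (rule G(2))
    then show ?case
      by (intro exI[of _ "{A \<in> E (Suc m). A \<subseteq> \<Union>G}"] conjI) blast+
  qed
  with that show thesis by meson
qed

lemma partition_algebraI: "F \<subseteq> E n \<Longrightarrow> \<Union>F \<in> B"
  unfolding partition_algebra_def using finite_subset[OF _ finite_cells] by blast

text \<open>A finite union involves finitely many levels, and all its cells can be subdivided down
  to the largest of them.\<close>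

lemma partition_algebra_single_level:
  assumes "S \<in> B"
  obtains n F where "F \<subseteq> E n" "S = \<Union>F"
proof -
  obtain F where "finite F" "F \<subseteq> (\<Union>n. E n)" "S = \<Union>F"
    using assms by (auto simp: partition_algebra_def)
  then have "\<exists>n. \<exists>G\<subseteq>E n. S = \<Union>G"
  proof (induction F arbitrary: S)
    case empty
    then show ?case by blast
  next
    case (insert A F)
    then obtain k n G where *: "A \<in> E k" "G \<subseteq> E n" "\<Union>F = \<Union>G" by (auto; metis)
    obtain H where "H \<subseteq> E (max k n)" "\<Union>H = \<Union>{A}"
      using Union_cells_at_later_level[of "{A}" k "max k n"] * by auto
    moreover obtain G' where "G' \<subseteq> E (max k n)" "\<Union>G' = \<Union>G"
      using Union_cells_at_later_level[of G n "max k n"] * by auto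
    ultimately show ?case
      using insert.prems *
      by (intro exI[of _ "max k n"] exI[of _ "H \<union> G'"]) auto
  qed
  with that show thesis by blast
qed

lemma partition_algebra_common_level:
  assumes "S \<in> B" "T \<in> B"
  obtains n F G where "F \<subseteq> E n" "G \<subseteq> E n" "S = \<Union>F" "T = \<Union>G"
proof -
  obtain k F where F: "F \<subseteq> E k" "S = \<Union>F"
    using assms(1) by (rule partition_algebra_single_level)
  obtain l G where G: "G \<subseteq> E l" "T = \<Union>G"
    using assms(2) by (rule partition_algebra_single_level)
  obtain F' where "F' \<subseteq> E (max k l)" "\<Union>F' = \<Union>F"
    using Union_cells_at_later_level[OF F(1) max.cobounded1] .
  moreover obtain G' where "G' \<subseteq> E (max k l)" "\<Union>G' = \<Union>G"
    using Union_cells_at_later_level[OF G(1) max.cobounded2] .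
  ultimately show thesis using F G that by metis
qed

lemma Compl_cells:
  assumes "F \<subseteq> E n"
  shows "\<Omega> - \<Union>F = \<Union>(E n - F)"
proof -
  have "x \<notin> \<Union>F" if "x \<in> P" "P \<in> E n - F" for x P
    using that assms disjoint_cells[of P n] by blast
  then show ?thesis using assms Union_cells[of n] by blast
qed

lemma algebra_partition_algebra: "algebra \<Omega> B"
  unfolding algebra_iff_Un
proof (intro conjI ballI)
  show "B \<subseteq> Pow \<Omega>"
    using Union_cells by (force simp: partition_algebra_def)
  show "{} \<in> B" using partition_algebraI[of "{}"] by simp
  show "\<Omega> - S \<in> B" if "S \<in> B" for S
  proof -
    from that obtain n F where "F \<subseteq> E n" "S = \<Union>F" by (rule partition_algebra_single_level)
    then show ?thesis using partition_algebraI[of "E n - F" n] Compl_cells by auto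
  qed
  show "S \<union> T \<in> B" if "S \<in> B" "T \<in> B" for S T
  proof -
    from that obtain n F G where "F \<subseteq> E n" "G \<subseteq> E n" "S = \<Union>F" "T = \<Union>G"
      by (rule partition_algebra_common_level)
    then show ?thesis using partition_algebraI[of "F \<union> G" n] by auto
  qed
qed

lemma clopen_partition_algebra:
  assumes "S \<in> B"
  shows "clopenin (top_of_set \<Omega>) S"
proof -
  obtain F where "finite F" "F \<subseteq> (\<Union>n. E n)" "S = \<Union>F"
    using assms by (auto simp: partition_algebra_def)
  then show ?thesis
    using clopen_cells unfolding clopenin_def by (blast intro: openin_Union closedin_Union)
qed

section \<open>Cells as a base of the topology, and the Borel sets they generate\<close>

lemma exists_small_cell:
  assumes "openin (top_of_set \<Omega>) U" "x \<in> U"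
  obtains n A where "A \<in> E n" "x \<in> A" "A \<subseteq> U"
proof -
  obtain e where e: "0 < e" "ball x e \<inter> \<Omega> \<subseteq> U" and x: "x \<in> \<Omega>"
    using assms unfolding openin_contains_ball by blast
  have "\<forall>\<^sub>F n in sequentially. mesh (E n) < e"
    using mesh_tendsto_0 e(1) by (rule order_tendstoD)
  then obtain n where n: "mesh (E n) < e" by (auto simp: eventually_sequentially)
  obtain A where A: "A \<in> E n" "x \<in> A" using x Union_cells[of n] by blast
  then have "A \<subseteq> \<Omega>" using Union_cells by blast
  \<comment> \<open>\<open>diameter\<close> bounds distances only in a bounded set; here compactness
    of the whole space supplies this.\<close>
  then have "bounded A" using compact compact_imp_bounded bounded_subset by blast
  have "diameter A \<le> mesh (E n)"
    unfolding mesh_def using A finite_cells by (intro Max_ge) auto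
  then have "dist x y < e" if "y \<in> A" for y
    using diameter_bounded_bound[OF \<open>bounded A\<close> A(2) that] n by linarith
  with \<open>A \<subseteq> \<Omega>\<close> e have "A \<subseteq> U" by (auto simp: subset_iff)
  with A that show thesis by blast
qed

lemma openin_Union_cells:
  assumes "openin (top_of_set \<Omega>) U"
  shows "\<Union>{A \<in> \<Union>n. E n. A \<subseteq> U} = U"
proof (intro equalityI subsetI)
  fix x assume "x \<in> U"
  with assms obtain n A where "A \<in> E n" "x \<in> A" "A \<subseteq> U" by (rule exists_small_cell)
  then show "x \<in> \<Union>{A \<in> \<Union>n. E n. A \<subseteq> U}" by auto
qed auto

lemma sigma_sets_partition_algebra: "sigma_sets \<Omega> B = sets (restrict_space borel \<Omega>)"
proof
  have "\<Omega> \<in> sets borel" by (intro borel_closed compact_imp_closed compact)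
  have "B \<subseteq> sets (restrict_space borel \<Omega>)"
  proof
    fix S assume "S \<in> B"
    then obtain U where "open U" "S = \<Omega> \<inter> U"
      using clopen_partition_algebra unfolding clopenin_def openin_open by meson
    then show "S \<in> sets (restrict_space borel \<Omega>)"
      by (simp add: sets_restrict_space)
  qed
  then show "sigma_sets \<Omega> B \<subseteq> sets (restrict_space borel \<Omega>)"
    using sets.sigma_sets_subset[of B "restrict_space borel \<Omega>"] by (simp add: space_restrict_space)
  have "\<Omega> \<inter> U \<in> sigma_sets \<Omega> B" if "open U" for U
  proof -
    let ?C = "{A \<in> \<Union>n. E n. A \<subseteq> \<Omega> \<inter> U}"
    \<comment> \<open>There are countably many cells in all, so writing an open set as the union of
      the cells inside it stays within the sigma-algebra.\<close>
    have "countable (\<Union>n. E n)" using finite_cells by (intro countable_UN) (auto simp: countable_finite)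
    then have "countable ?C" by (rule countable_subset[rotated]) blast
    moreover have "A \<in> B" if "A \<in> E n" for A n
      using partition_algebraI[of "{A}" n] that by simp
    ultimately have "\<Union>?C \<in> sigma_sets \<Omega> B"
      by (intro sigma_sets_UNION) (auto intro: sigma_sets.Basic)
    then show ?thesis
      using openin_Union_cells[OF openin_open_Int[OF \<open>open U\<close>]] by simp
  qed
  then have "(\<inter>) \<Omega> ` {U. open U} \<subseteq> sigma_sets \<Omega> B" by blast
  then have "sigma_sets \<Omega> ((\<inter>) \<Omega> ` {U. open U}) \<subseteq> sigma_sets \<Omega> B"
    by (rule sigma_sets_mono)
  \<comment> \<open>The trace of a generated sigma-algebra is generated by the traces of the
    generators, provided the subset is measurable; \<Omega> is compact, hence closed.\<close>
  moreover have "sets (restrict_space borel \<Omega>) = sigma_sets \<Omega> ((\<inter>) \<Omega> ` {U. open U})"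
    using \<open>\<Omega> \<in> sets borel\<close>
    by (simp add: sets_restrict_space sets_borel sigma_sets_Int[of \<Omega> UNIV])
  ultimately show "sets (restrict_space borel \<Omega>) \<subseteq> sigma_sets \<Omega> B" by simp
qed

text \<open>The cells inside \<open>U\<close> form an open cover of the compact set
  \<open>K\<close>, and a finite subcover has its union in the algebra. This turns topological
  approximation into approximation by cells.\<close>

lemma partition_algebra_between:
  assumes "closedin (top_of_set \<Omega>) K" "openin (top_of_set \<Omega>) U" "K \<subseteq> U"
  obtains S where "S \<in> B" "K \<subseteq> S" "S \<subseteq> U"
proof -
  let ?C = "{A \<in> \<Union>n. E n. A \<subseteq> U}"
  have "compactin (top_of_set \<Omega>) K"
    using assms(1) compact by (intro closedin_compact_space) (simp_all add: compact_space_subtopology)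
  moreover have "openin (top_of_set \<Omega>) A" if "A \<in> ?C" for A
    using that clopen_cells by (auto simp: clopenin_def)
  moreover have "K \<subseteq> \<Union>?C"
    unfolding openin_Union_cells[OF assms(2)] by fact
  ultimately obtain F where F: "finite F" "F \<subseteq> ?C" "K \<subseteq> \<Union>F"
    using compactinD[of "top_of_set \<Omega>" K ?C] by meson
  have "\<Union>F \<in> B" using F(1,2) unfolding partition_algebra_def by blast
  moreover have "\<Union>F \<subseteq> U" using F(2) by blast
  ultimately show thesis using F(3) that by meson
qed

section \<open>The equidistributed measure\<close>

lemma cell_weight_pos:
  assumes "A \<in> E n"
  shows "0 < cell_weight E n A"
  using assms
proof (induction n arbitrary: A)
  case (Suc n)
  then obtain P where P: "P \<in> E n" "A \<subseteq> P" using refines unfolding refines_def by blast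
  \<comment> \<open>The children of \<open>P\<close> include \<open>A\<close> itself, so the
    recursion never divides by zero.\<close>
  have "card {C \<in> E (Suc n). C \<subseteq> P} > 0"
    using finite_cells P Suc.prems by (auto simp: card_gt_0_iff)
  with Suc.IH[OF P(1)] show ?case
    by (simp add: Let_def refines_parent[OF refines P(1) Suc.prems P(2)])
qed simp

lemmas rho_Union_cells = rho_Union[of E, OF finite_cells refines]

lemma rho_nonneg:
  assumes "S \<in> B"
  shows "0 \<le> rho E S"
proof -
  obtain n F where F: "F \<subseteq> E n" and S: "S = \<Union>F"
    using assms by (rule partition_algebra_single_level)
  have "0 \<le> cell_weight E n A" if "A \<in> F" for A
    using cell_weight_pos[of A n] that F by auto
  then show ?thesis
    unfolding S rho_Union_cells[OF F] by (intro sum_nonneg)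
qed

lemma rho_empty: "rho E {} = 0"
  using rho_Union_cells[of "{}"] by simp

lemma rho_cell: "A \<in> E n \<Longrightarrow> rho E A = cell_weight E n A"
  using rho_Union_cells[of "{A}" n] by simp

text \<open>At a common level both sets are indexed by families of cells. A shared cell would be a
  nonempty subset of the intersection, so the families are disjoint and the sums add.\<close>

lemma rho_Un_disjoint:
  assumes "S \<in> B" "T \<in> B" "S \<inter> T = {}"
  shows "rho E (S \<union> T) = rho E S + rho E T"
proof -
  obtain n F G where *: "F \<subseteq> E n" "G \<subseteq> E n" "S = \<Union>F" "T = \<Union>G"
    using assms(1,2) by (rule partition_algebra_common_level)
  have "F \<inter> G = {}"
  proof (rule ccontr)
    assume "F \<inter> G \<noteq> {}"
    then obtain A where A: "A \<in> F" "A \<in> G" by blast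
    then have "A \<subseteq> S \<inter> T" using * by blast
    with assms(3) cell_nonempty[of A n] A * show False by blast
  qed
  moreover have "finite F" "finite G" using * finite_cells finite_subset by blast+
  moreover have "S \<union> T = \<Union>(F \<union> G)" using * by blast
  ultimately show ?thesis
    using * rho_Union_cells[of "F \<union> G" n] rho_Union_cells[of F n] rho_Union_cells[of G n]
    by (simp add: sum.union_disjoint)
qed

text \<open>Members of the algebra are compact because they are clopen in \<Omega>, so the finite
  intersection property applies. This supplies the continuity at the empty set for Caratheodory's
  theorem.\<close>

lemma decseq_partition_algebra_eventually_empty:
  assumes S: "range S \<subseteq> B" "decseq S" and "(\<Inter>i. S i) = {}"
  obtains n where "S n = {}"
proof -
  have "closedin (top_of_set \<Omega>) (S i)" for i
    using S(1) clopen_partition_algebra[of "S i"] by (auto simp: clopenin_def)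
  then have cl: "compact (S i)" "S i \<subseteq> \<Omega>" for i
    using compact by (auto intro: closedin_compact dest: closedin_imp_subset)
  have "\<exists>n. S n = {}"
  proof (rule ccontr)
    assume ne: "\<nexists>n. S n = {}"
    have "\<Omega> \<inter> (\<Inter>i\<in>UNIV. S i) \<noteq> {}"
    proof (rule compact_imp_fip_image[OF compact])
      show "closed (S i)" for i using cl(1) by (rule compact_imp_closed)
      fix I :: "nat set" assume "finite I"
      then obtain n where "I \<subseteq> {..n}" using finite_nat_iff_bounded_le by auto
      then have "S n \<subseteq> \<Omega> \<inter> (\<Inter>i\<in>I. S i)"
        by (intro Int_greatest INF_greatest cl(2) decseqD[OF S(2)]) auto
      with ne show "\<Omega> \<inter> (\<Inter>i\<in>I. S i) \<noteq> {}" by (metis subset_empty)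
    qed
    with assms(3) show False by simp
  qed
  with that show thesis by blast
qed

lemma rho_extension:
  obtains M where "finite_measure M" "space M = \<Omega>" "sets M = sigma_sets \<Omega> B"
    "\<And>S. S \<in> B \<Longrightarrow> measure M S = rho E S"
proof -
  interpret algebra \<Omega> B by (rule algebra_partition_algebra)
  let ?f = "\<lambda>S. ennreal (rho E S)"
  have "\<exists>\<mu> :: 'a set \<Rightarrow> ennreal. (\<forall>S\<in>B. \<mu> S = ?f S) \<and> measure_space \<Omega> (sigma_sets \<Omega> B) \<mu>"
  proof (rule caratheodory_empty_continuous)
    show "positive B ?f" by (simp add: positive_def rho_empty)
    show "additive B ?f"
      by (simp add: additive_def rho_Un_disjoint rho_nonneg)
    fix S assume S: "range S \<subseteq> B" "decseq S" "(\<Inter>i::nat. S i) = {}"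
    then obtain n where "S n = {}" by (rule decseq_partition_algebra_eventually_empty)
    \<comment> \<open>The values of \<open>rho\<close> are not merely small but equal to 0 from this
      index on.\<close>
    then have "S m = {}" if "n \<le> m" for m using decseqD[OF S(2) that] by simp
    then have "\<forall>\<^sub>F m in sequentially. ?f (S m) = 0"
      using rho_empty by (intro eventually_sequentiallyI[of n]) simp
    then show "(\<lambda>m. ?f (S m)) \<longlonglongrightarrow> 0" by (rule tendsto_eventually)
  qed simp
  then obtain \<mu> :: "'a set \<Rightarrow> ennreal" where \<mu>: "\<And>S. S \<in> B \<Longrightarrow> \<mu> S = ?f S"
    and ms: "measure_space \<Omega> (sigma_sets \<Omega> B) \<mu>"
    by blast
  define M where "M = measure_of \<Omega> (sigma_sets \<Omega> B) \<mu>"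
  have sp: "space M = \<Omega>" and sets: "sets M = sigma_sets \<Omega> B"
    unfolding M_def using space_closed sigma_sets_into_sp[of B \<Omega>]
    by (auto simp: space_measure_of_conv sigma_sets_sigma_sets_eq sets_measure_of_conv)
  have em: "emeasure M S = ?f S" if "S \<in> B" for S
    using ms \<mu>[OF that] that unfolding M_def
    by (subst emeasure_measure_of_sigma) (auto simp: measure_space_def)
  \<comment> \<open>The total mass is the \<open>ennreal\<close> image of a real number, hence
    finite.\<close>
  have "finite_measure M"
    using em[OF top] by (intro finite_measureI) (simp add: sp)
  moreover have "measure M S = rho E S" if "S \<in> B" for S
    using em[OF that] rho_nonneg[OF that] by (simp add: measure_def)
  ultimately show thesis using that sp sets by blast
qed

section \<open>Step functions along the partitions and their density\<close>

lemma indicator_Union_cells_step_function: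
  assumes "F \<subseteq> E n"
  shows "indicator (\<Union>F) \<in> step_functions (E n)"
proof -
  \<comment> \<open>The coefficient of a cell is 1 or 0 according to its membership in
    \<open>F\<close>; disjointness of the cells prevents double counting.\<close>
  have "indicator (\<Union>F) x = (\<Sum>A\<in>E n. indicator F A * indicator A x :: real)" for x
  proof -
    have "(\<Sum>A\<in>E n. indicator F A * indicator A x :: real) = (\<Sum>A\<in>F. indicator A x)"
      using assms finite_cells by (intro sum.mono_neutral_cong_right) auto
    also have "\<dots> = indicator (\<Union>A\<in>F. A) x"
      using finite_subset[OF assms finite_cells]
    proof (rule indicator_UN_disjoint[symmetric])
      show "disjoint_family_on (\<lambda>A. A) F"
        unfolding disjoint_family_on_def using disjoint_cells subsetD[OF assms] by meson
    qed
    finally show ?thesis by simp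
  qed
  then show ?thesis unfolding step_functions_def by blast
qed

text \<open>A coarse cell is a union of finer ones, so its indicator is a step function at the finer
  level. Nestedness makes the union over all levels closed under addition.\<close>

lemma step_functions_mono:
  assumes "n \<le> m"
  shows "step_functions (E n) \<subseteq> step_functions (E m)"
proof
  fix f :: "'a \<Rightarrow> real" assume "f \<in> step_functions (E n)"
  then obtain c where f: "f = (\<lambda>x. \<Sum>A\<in>E n. c A * indicator A x)"
    by (auto simp: step_functions_def)
  have "indicator A \<in> step_functions (E m)" if A: "A \<in> E n" for A
  proof -
    obtain G where "G \<subseteq> E m" "\<Union>G = \<Union>{A}"
      using Union_cells_at_later_level[of "{A}" n m] A assms by auto
    with indicator_Union_cells_step_function[of G m] show ?thesis by simp
  qed
  then show "f \<in> step_functions (E m)"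
    unfolding f by (intro step_functions_sum step_functions_cmult)
qed

text \<open>By \<open>dense_in_L2I\<close> only indicators matter. If a member \<open>S\<close> of
  the algebra lies between \<open>K\<close> and \<open>U\<close>, as \<open>A\<close> does, then
  \<open>A\<close> and \<open>S\<close> differ only inside U - K, so the squared distance of their
  indicators is at most the measure of U - K.\<close>

lemma step_functions_dense_in_L2:
  assumes "finite_measure M" and sp: "space M = \<Omega>" and B: "B \<subseteq> sets M"
    and approx: "\<And>A e. A \<in> sets M \<Longrightarrow> 0 < e \<Longrightarrow>
      \<exists>K U. closedin (top_of_set \<Omega>) K \<and> openin (top_of_set \<Omega>) U \<and> K \<subseteq> A \<and> A \<subseteq> U
        \<and> U - K \<in> sets M \<and> measure M (U - K) < e"
  shows "dense_in_L2 M (\<Union>n. step_functions (E n))"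
proof -
  interpret finite_measure M by fact
  show ?thesis
  proof (rule dense_in_L2I)
    have "A \<in> sets M" if "A \<in> E n" for A n
      using partition_algebraI[of "{A}" n] that B by auto
    then show "(\<Union>n. step_functions (E n)) \<subseteq> L2_functions M"
      unfolding step_functions_def
      by (auto intro!: L2_functions_sum L2_functions_cmult indicator_in_L2_functions)
    show "(\<lambda>x. 0) \<in> (\<Union>n. step_functions (E n))" using step_functions_zero by blast
    show "(\<lambda>x. c * f x) \<in> (\<Union>n. step_functions (E n))"
      if "f \<in> (\<Union>n. step_functions (E n))" for c f
      using that step_functions_cmult by blast
    show "(\<lambda>x. f x + g x) \<in> (\<Union>n. step_functions (E n))"
      if "f \<in> (\<Union>n. step_functions (E n))" "g \<in> (\<Union>n. step_functions (E n))" for f g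
    proof -
      from that obtain m n where "f \<in> step_functions (E m)" "g \<in> step_functions (E n)" by blast
      then have "f \<in> step_functions (E (max m n))" "g \<in> step_functions (E (max m n))"
        using step_functions_mono[of m "max m n"] step_functions_mono[of n "max m n"] by auto
      then show ?thesis using step_functions_add by blast
    qed
    fix A and e :: real assume A: "A \<in> sets M" and "0 < e"
    then obtain K U where KU: "closedin (top_of_set \<Omega>) K" "openin (top_of_set \<Omega>) U"
      "K \<subseteq> A" "A \<subseteq> U" "U - K \<in> sets M" "measure M (U - K) < e"
      using approx by meson
    then have "K \<subseteq> U" by blast
    with KU obtain S where S: "S \<in> B" "K \<subseteq> S" "S \<subseteq> U"
      by (meson partition_algebra_between)
    obtain n F where "F \<subseteq> E n" "S = \<Union>F" using S(1) by (rule partition_algebra_single_level)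
    then have "indicator S \<in> (\<Union>n. step_functions (E n))"
      using indicator_Union_cells_step_function by blast
    moreover have "(\<integral>x. (indicator A x - indicator S x :: real)\<^sup>2 \<partial>M) \<le> (\<integral>x. indicator (U - K) x \<partial>M)"
    proof (rule integral_mono)
      have "(\<lambda>x. indicator A x - indicator S x) \<in> L2_functions M"
        using A S B by (intro L2_functions_diff indicator_in_L2_functions) auto
      then show "integrable M (\<lambda>x. (indicator A x - indicator S x :: real)\<^sup>2)"
        by (simp add: L2_functions_def)
      show "integrable M (indicator (U - K) :: 'a \<Rightarrow> real)"
        using KU by (simp add: less_top[symmetric])
      show "(indicator A x - indicator S x :: real)\<^sup>2 \<le> indicator (U - K) x" for x
        using KU S by (auto split: split_indicator)
    qed
    moreover have "(\<integral>x. indicator (U - K) x \<partial>M) = measure M (U - K)"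
      using KU(5) sets.sets_into_space by (simp add: Int_absorb2)
    ultimately show "\<exists>g\<in>\<Union>n. step_functions (E n). (\<integral>x. (indicator A x - g x)\<^sup>2 \<partial>M) < e"
      using KU(6) by (intro bexI[of _ "indicator S"]) auto
  qed
qed

end

theorem theorem3p4:
  fixes \<Omega> :: "'a::metric_space set" and E :: "nat \<Rightarrow> 'a set set"
  assumes "\<Omega> \<noteq> {}" and "compact \<Omega>" and "totally_disconnected \<Omega>"
    and "\<And>n. partition_on \<Omega> (E n)"
    and "\<And>n. finite (E n)"
    and "\<And>n A. A \<in> E n \<Longrightarrow> clopenin (top_of_set \<Omega>) A"
    and "\<And>n. refines \<Omega> (E (Suc n)) (E n)"
    and "E 0 = {\<Omega>}"
    and "(\<lambda>n. mesh (E n)) \<longlonglongrightarrow> 0"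
  shows "\<exists>M. radon_measure_on \<Omega> M
           \<and> (\<forall>S\<in>partition_algebra E. S \<in> sets M \<and> measure M S = rho E S)
           \<and> (\<forall>I. clopenin (top_of_set \<Omega>) I \<and> I \<noteq> {} \<longrightarrow> measure M I > 0)
           \<and> dense_in_L2 M (\<Union>n. step_functions (E n))"
proof -
  interpret clopen_partitions \<Omega> E
    using assms by unfold_locales auto
  obtain M where "finite_measure M" and sp: "space M = \<Omega>" and sets: "sets M = sigma_sets \<Omega> B"
    and rho: "\<And>S. S \<in> B \<Longrightarrow> measure M S = rho E S"
    by (rule rho_extension) blast
  interpret finite_measure M by fact
  have borel: "sets M = sets (restrict_space borel \<Omega>)"
    using sets sigma_sets_partition_algebra by simp
  have B: "B \<subseteq> sets M" unfolding sets by (rule sigma_sets_superset_generator)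
  have op: "U \<in> sets M" if "openin (top_of_set \<Omega>) U" for U
    using that unfolding borel sets_restrict_space openin_open by auto
  have cl: "K \<in> sets M" if "closedin (top_of_set \<Omega>) K" for K
  proof -
    obtain C where "closed C" "K = \<Omega> \<inter> C"
      using \<open>closedin (top_of_set \<Omega>) K\<close> unfolding closedin_closed by blast
    then show ?thesis
      unfolding borel sets_restrict_space by (simp add: borel_closed)
  qed
  \<comment> \<open>This sandwich is used twice, for regularity and for density. The clopen
    generators are the members of \<open>B\<close>.\<close>
  have approx: "\<exists>K U. closedin (top_of_set \<Omega>) K \<and> openin (top_of_set \<Omega>) U \<and> K \<subseteq> A \<and> A \<subseteq> U
        \<and> measure M (U - K) < e" if "A \<in> sets M" "0 < e" for A e
    using closed_open_approximation[of "top_of_set \<Omega>" B A e] that op sets sp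
      clopen_partition_algebra by (metis topspace_euclidean_subtopology)
  have "radon_measure_on \<Omega> M"
    using \<open>finite_measure M\<close> borel compact approx by (rule radon_measure_onI)
  moreover have "0 < measure M I" if "clopenin (top_of_set \<Omega>) I" "I \<noteq> {}" for I
  proof -
    from that obtain x where x: "x \<in> I" "openin (top_of_set \<Omega>) I" by (auto simp: clopenin_def)
    obtain n A where A: "A \<in> E n" "A \<subseteq> I" using exists_small_cell[OF x(2,1)] by metis
    then have "A \<in> B" using partition_algebraI[of "{A}" n] by simp
    with A rho have "0 < measure M A" by (simp add: rho_cell cell_weight_pos)
    also have "\<dots> \<le> measure M I" using A op x by (intro finite_measure_mono) auto
    finally show ?thesis .
  qed
  moreover have "dense_in_L2 M (\<Union>n. step_functions (E n))"
  proof (rule step_functions_dense_in_L2)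
    show "\<exists>K U. closedin (top_of_set \<Omega>) K \<and> openin (top_of_set \<Omega>) U \<and> K \<subseteq> A \<and> A \<subseteq> U
        \<and> U - K \<in> sets M \<and> measure M (U - K) < e" if "A \<in> sets M" "0 < e" for A e
      using approx[OF that] op cl by (meson sets.Diff)
  qed (use B sp \<open>finite_measure M\<close> in auto)
  ultimately show ?thesis using B rho by blast
qed

end
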